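(* Let $G$ and $H$ be graphs and let $m$ and $n$ be positive integers. If $S$ is a subgraph of the or-product $G\circledcirc H$, then \[ N(S,mn)\ge \min\{N(G,m),N(H,n)\}. \]
   Context: All graphs are finite simple graphs. A subgraph $S$ of a graph $X$ satisfies $V(S)\subseteq V(X)$ and $E(S)\subseteq E(X)$. The or-product $G\circledcirc H$ is the graph with vertex set $V(G)\times V(H)$ in which distinct vertices $(u,v)$ and $(u',v')$ are adjacent if and only if $u$ is adjacent to $u'$ in $G$ or $v$ is adjacent to $v'$ in $H$. An $n$-coloring of a graph is a proper vertex coloring using at most $n$ colors. Two colorings $C_1,C_2$ of a graph are orthogonal if whenever two distinct vertices share a color in $C_1$, they have distinct colors in $C_2$. $N(X,n)$ denotes the maximum size of a set of pairwise orthogonal $n$-colorings of the graph $X$. *)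

theory Defs
  imports "Graph_Theory.Graph_Theory" "HOL-Library.Extended_Nat" "HOL-Library.FuncSet"
begin

text \<open>
  A finite simple graph is a \<^locale>\<open>pair_graph\<close> of the library: a finite loop-free digraph without parallel
  arcs whose arc relation is symmetric, so \<open>u\<close> and \<open>v\<close> are adjacent iff
  \<open>(u, v) \<in> parcs X\<close>.  The null graph is allowed.
\<close>

definition or_product :: "'a pair_pre_digraph \<Rightarrow> 'b pair_pre_digraph \<Rightarrow> ('a \<times> 'b) pair_pre_digraph"
  where "or_product G H =
    \<lparr> pverts = pverts G \<times> pverts H,
      parcs = {((u, v), (u', v')) | u v u' v'.
        (u, v) \<in> pverts G \<times> pverts H \<and> (u', v') \<in> pverts G \<times> pverts H \<and> (u, v) \<noteq> (u', v') \<and>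
        ((u, u') \<in> parcs G \<or> (v, v') \<in> parcs H)} \<rparr>"

definition n_coloring :: "'v pair_pre_digraph \<Rightarrow> nat \<Rightarrow> ('v \<Rightarrow> nat) \<Rightarrow> bool"
  where "n_coloring X n c \<longleftrightarrow>
    (\<forall>u v. (u, v) \<in> parcs X \<longrightarrow> c u \<noteq> c v) \<and> card (c ` pverts X) \<le> n"

definition orthogonal_colorings :: "'v pair_pre_digraph \<Rightarrow> ('v \<Rightarrow> nat) \<Rightarrow> ('v \<Rightarrow> nat) \<Rightarrow> bool"
  where "orthogonal_colorings X c d \<longleftrightarrow>
    (\<forall>u\<in>pverts X. \<forall>v\<in>pverts X. u \<noteq> v \<longrightarrow> c u = c v \<longrightarrow> d u \<noteq> d v)"

definition orthogonal_family :: "'v pair_pre_digraph \<Rightarrow> nat \<Rightarrow> nat \<Rightarrow> (nat \<Rightarrow> 'v \<Rightarrow> nat) \<Rightarrow> bool"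
  where "orthogonal_family X n k c \<longleftrightarrow>
    (\<forall>i<k. n_coloring X n (c i)) \<and>
    (\<forall>i<k. \<forall>j<k. i \<noteq> j \<longrightarrow> orthogonal_colorings X (c i) (c j))"

text \<open>
  A set of \<open>k\<close> pairwise orthogonal colorings is read as a family of \<open>k\<close> colorings, any two
  members of which are orthogonal.  Repetitions are possible only for a coloring that is injective
  on the vertices, since only such a coloring is orthogonal to itself.  Hence the distinction from
  sets matters only if there are at most \<open>n\<close> vertices; then the family may be arbitrarily large
  and the value is \<open>\<infinity>\<close> (lemma \<open>N_infinite\<close>).  For more than \<open>n\<close> vertices the value is the
  maximum cardinality of a set of pairwise orthogonal colorings with a fixed palette of
  \<open>n\<close> colors (lemma \<open>N_eq_Max\<close>).  Insisting on distinct maps into a fixed palette, or on distinct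
  partitions, in the degenerate range would make the invariant non-monotone under subgraphs: a
  single vertex has only \<open>n\<close> such maps and only one such partition.
\<close>

definition N :: "'v pair_pre_digraph \<Rightarrow> nat \<Rightarrow> enat"
  where "N X n = (SUP k \<in> {k. \<exists>c. orthogonal_family X n k c}. enat k)"

lemma N_infinite:
  assumes X: "pair_graph X" and le: "card (pverts X) \<le> n"
  shows "N X n = \<infinity>"
proof -
  interpret pair_graph X by (rule X)
  obtain e :: "'a \<Rightarrow> nat" where e: "inj_on e (pverts X)"
    using finite_imp_inj_to_nat_seg[OF pair_finite_verts] by blast
  have "n_coloring X n e"
    unfolding n_coloring_def
  proof (intro conjI allI impI)
    fix u v assume uv: "(u, v) \<in> parcs X"
    have "u \<noteq> v" using pair_no_loops[OF uv] by simp
    then show "e u \<noteq> e v"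
      using e in_arcsD1[OF uv] in_arcsD2[OF uv] by (auto dest: inj_onD)
  next
    show "card (e ` pverts X) \<le> n" using e le by (simp add: card_image)
  qed
  moreover have "orthogonal_colorings X e e"
    using e by (auto simp: orthogonal_colorings_def dest: inj_onD)
  ultimately have "orthogonal_family X n k (\<lambda>_. e)" for k
    by (simp add: orthogonal_family_def)
  then have "enat k \<le> N X n" for k
    unfolding N_def by (intro SUP_upper) auto
  then have le: "\<And>k. enat k \<le> N X n" .
  show ?thesis
  proof (cases "N X n")
    case (enat j)
    then show ?thesis using le[of "Suc j"] by simp
  qed simp
qed

lemma N_eq_Max:
  assumes X: "pair_graph X" and gt: "n < card (pverts X)"
  shows "N X n = enat (Max {card F | F. F \<subseteq> {c \<in> pverts X \<rightarrow>\<^sub>E {..<n}. n_coloring X n c} \<and>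
    pairwise (orthogonal_colorings X) F})" (is "_ = enat (Max ?M)")
proof (rule antisym)
  interpret pair_graph X by (rule X)
  let ?P = "pverts X \<rightarrow>\<^sub>E {..<n}"
  have finP: "finite ?P" by (intro finite_PiE) (auto simp: pair_finite_verts)
  have "?M \<subseteq> card ` Pow ?P" by auto
  then have finM: "finite ?M" by (rule finite_subset) (simp add: finP)
  show "N X n \<le> enat (Max ?M)"
    unfolding N_def
  proof (rule SUP_least)
    fix k assume "k \<in> {k. \<exists>c. orthogonal_family X n k c}"
    then obtain c where c: "orthogonal_family X n k c" by blast
    have ex: "\<exists>h. h ` (c i ` pverts X) \<subseteq> {..<n} \<and> inj_on h (c i ` pverts X)" if "i < k" for i
    proof (rule card_le_inj)
      show "finite (c i ` pverts X)" using pair_finite_verts by (rule finite_imageI)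
      show "card (c i ` pverts X) \<le> card {..<n}"
        using c that by (simp add: orthogonal_family_def n_coloring_def)
    qed simp
    define h where
      "h i = (SOME h. h ` (c i ` pverts X) \<subseteq> {..<n} \<and> inj_on h (c i ` pverts X))" for i
    have h': "h i ` (c i ` pverts X) \<subseteq> {..<n} \<and> inj_on (h i) (c i ` pverts X)" if "i < k" for i
      unfolding h_def using someI_ex[OF ex[OF that]] .
    have h: "\<And>i. i < k \<Longrightarrow> inj_on (h i) (c i ` pverts X)"
      "\<And>i. i < k \<Longrightarrow> h i ` (c i ` pverts X) \<subseteq> {..<n}"
      using h' by simp_all
    define d where "d i = restrict (\<lambda>v. h i (c i v)) (pverts X)" for i
    have dP: "d i \<in> ?P" if "i < k" for i
      using h(2)[OF that] by (auto simp: d_def)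
    have deq: "d i u = d i v \<longleftrightarrow> c i u = c i v"
      if "i < k" "u \<in> pverts X" "v \<in> pverts X" for i u v
      using inj_on_eq_iff[OF h(1)[OF that(1)], of "c i u" "c i v"] that(2,3) by (simp add: d_def)
    have dcol: "n_coloring X n (d i)" if i: "i < k" for i
      unfolding n_coloring_def
    proof (intro conjI allI impI)
      fix u v assume uv: "(u, v) \<in> parcs X"
      show "d i u \<noteq> d i v"
        using deq[OF i in_arcsD1[OF uv] in_arcsD2[OF uv]] c i uv
        by (auto simp: orthogonal_family_def n_coloring_def)
    next
      have "d i ` pverts X \<subseteq> {..<n}" using dP[OF i] by auto
      from card_mono[OF _ this] show "card (d i ` pverts X) \<le> n" by simp
    qed
    have dorth: "orthogonal_colorings X (d i) (d j)" if "i < k" "j < k" "i \<noteq> j" for i j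
    proof -
      have "orthogonal_colorings X (c i) (c j)"
        using c that by (auto simp: orthogonal_family_def)
      then show ?thesis
        unfolding orthogonal_colorings_def using deq that by simp
    qed
    have inj: "inj_on d {..<k}"
    proof (rule inj_onI, rule ccontr)
      fix i j assume ij: "i \<in> {..<k}" "j \<in> {..<k}" "d i = d j" "i \<noteq> j"
      have "d i ` pverts X \<subseteq> {..<n}" using dP ij by auto
      from card_mono[OF _ this] have "\<not> inj_on (d i) (pverts X)"
        using gt by (auto dest: card_image)
      then obtain u v where "u \<in> pverts X" "v \<in> pverts X" "u \<noteq> v" "d i u = d i v"
        by (auto simp: inj_on_def)
      then show False
        using dorth[of i j] ij by (auto simp: orthogonal_colorings_def)
    qed
    have "card (d ` {..<k}) = k" using inj by (simp add: card_image)
    moreover have "card (d ` {..<k}) \<in> ?M"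
    proof -
      have "d ` {..<k} \<subseteq> {c \<in> ?P. n_coloring X n c}" using dP dcol by auto
      moreover have "pairwise (orthogonal_colorings X) (d ` {..<k})"
        using dorth by (auto simp: pairwise_def)
      ultimately show ?thesis by blast
    qed
    ultimately have "k \<in> ?M" by (simp only:)
    then show "enat k \<le> enat (Max ?M)" using finM by (simp only: enat_ord_simps) (rule Max_ge)
  qed
  have "card {} \<in> ?M" by (rule CollectI, rule exI[of _ "{}"]) auto
  then have "?M \<noteq> {}" by (rule ex_in_conv[THEN iffD1, OF exI])
  with finM have "Max ?M \<in> ?M" by (rule Max_in)
  then obtain F where F: "card F = Max ?M" "F \<subseteq> {c \<in> ?P. n_coloring X n c}"
    "pairwise (orthogonal_colorings X) F" by auto
  have "F \<subseteq> ?P" using F(2) by blast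
  then have "finite F" using finP by (rule finite_subset)
  then obtain g where g: "bij_betw g {..<card F} F"
    using ex_bij_betw_nat_finite[of F] by (auto simp: atLeast0LessThan)
  have "orthogonal_family X n (card F) g"
    unfolding orthogonal_family_def
  proof (intro conjI allI impI)
    fix i assume "i < card F"
    then have "g i \<in> F" using g by (auto simp: bij_betw_def)
    then show "n_coloring X n (g i)" using F(2) by auto
  next
    fix i j assume ij: "i < card F" "j < card F" "i \<noteq> j"
    then have "g i \<in> F" "g j \<in> F" "g i \<noteq> g j"
      using g by (auto simp: bij_betw_def dest: inj_onD)
    then show "orthogonal_colorings X (g i) (g j)" using F(3) by (auto simp: pairwise_def)
  qed
  then have "enat (card F) \<le> N X n" unfolding N_def by (intro SUP_upper) auto
  then show "enat (Max ?M) \<le> N X n" using F(1) by simp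
qed

end

(* A coloring of G with m colors and a coloring of H with n colors combine to the coloring of pairs
   of the or-product with mn colors.  If two distinct pairs share a color in the i-th product
   coloring, then they differ in some coordinate while agreeing in color there, so the j-th factor
   coloring already separates them in that coordinate. *)
theory Submission
  imports Defs
begin

text \<open>Colors are natural numbers and \<open>n_coloring\<close> counts only the colors that
  occur, so any injective pairing of naturals can encode a pair of colors; no palette of size mn has
  to be fixed.\<close>

definition product_coloring :: "('a \<Rightarrow> nat) \<Rightarrow> ('b \<Rightarrow> nat) \<Rightarrow> 'a \<times> 'b \<Rightarrow> nat"
  where "product_coloring c d = (\<lambda>(u, v). prod_encode (c u, d v))"

lemma product_coloring_eq_iff:
  "product_coloring c d (u, v) = product_coloring c d (u', v') \<longleftrightarrow> c u = c u' \<and> d v = d v'"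
  by (simp add: product_coloring_def)

text \<open>An edge of the or-product projects to an edge in at least one factor, and that component
  of the color pair already changes along it. The color pairs that occur lie in the product of the
  two sets of used colors.\<close>

lemma n_coloring_or_product:
  assumes fin: "finite (pverts G)" "finite (pverts H)"
    and c: "n_coloring G m c" and d: "n_coloring H n d"
  shows "n_coloring (or_product G H) (m * n) (product_coloring c d)"
  unfolding n_coloring_def
proof (intro conjI allI impI)
  fix x y assume "(x, y) \<in> parcs (or_product G H)"
  then show "product_coloring c d x \<noteq> product_coloring c d y"
    using c d by (auto simp: or_product_def n_coloring_def product_coloring_eq_iff)
next
  have "product_coloring c d ` pverts (or_product G H)
      \<subseteq> prod_encode ` (c ` pverts G \<times> d ` pverts H)"
    by (auto simp: product_coloring_def or_product_def)
  then have "card (product_coloring c d ` pverts (or_product G H))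
      \<le> card (prod_encode ` (c ` pverts G \<times> d ` pverts H))"
    using fin by (intro card_mono) auto
  also have "\<dots> \<le> card (c ` pverts G \<times> d ` pverts H)"
    using fin by (intro card_image_le) auto
  also have "\<dots> \<le> m * n"
    using c d by (auto simp: card_cartesian_product n_coloring_def intro: mult_le_mono)
  finally show "card (product_coloring c d ` pverts (or_product G H)) \<le> m * n" .
qed

lemma orthogonal_colorings_or_product:
  assumes "orthogonal_colorings G c c'" "orthogonal_colorings H d d'"
  shows "orthogonal_colorings (or_product G H) (product_coloring c d) (product_coloring c' d')"
  using assms
  by (fastforce simp: orthogonal_colorings_def or_product_def product_coloring_eq_iff)

text \<open>The i-th coloring of G is paired with the i-th coloring of H, so both families must have
  the same length k; this is the source of the minimum in the bound.\<close>

lemma orthogonal_family_or_product: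
  assumes "finite (pverts G)" "finite (pverts H)"
    and "orthogonal_family G m k c" "orthogonal_family H n k d"
  shows "orthogonal_family (or_product G H) (m * n) k (\<lambda>i. product_coloring (c i) (d i))"
  using assms
  by (simp add: orthogonal_family_def n_coloring_or_product orthogonal_colorings_or_product)

lemma n_coloring_mono:
  assumes "finite (pverts Y)" "pverts X \<subseteq> pverts Y" "parcs X \<subseteq> parcs Y" "n_coloring Y n c"
  shows "n_coloring X n c"
proof -
  have "card (c ` pverts X) \<le> card (c ` pverts Y)"
    using assms(1,2) by (intro card_mono) auto
  then show ?thesis using assms(3,4) by (auto simp: n_coloring_def)
qed

lemma orthogonal_colorings_mono:
  "pverts X \<subseteq> pverts Y \<Longrightarrow> orthogonal_colorings Y c d \<Longrightarrow> orthogonal_colorings X c d"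
  unfolding orthogonal_colorings_def by blast

text \<open>Properness is a condition on all arcs and orthogonality one on all pairs of vertices, so
  both survive deletion. Finiteness of \<open>Y\<close> is for the color count: \<open>card\<close>
  is monotone only below a finite set.\<close>

lemma orthogonal_family_mono:
  assumes "finite (pverts Y)" "pverts X \<subseteq> pverts Y" "parcs X \<subseteq> parcs Y"
    and "orthogonal_family Y n k c"
  shows "orthogonal_family X n k c"
  using assms(4) n_coloring_mono[OF assms(1-3)] orthogonal_colorings_mono[OF assms(2)]
  unfolding orthogonal_family_def by blast

lemma orthogonal_family_le:
  "orthogonal_family X n k c \<Longrightarrow> l \<le> k \<Longrightarrow> orthogonal_family X n l c"
  unfolding orthogonal_family_def by auto

text \<open>Strictly below the supremum there is always a family of finite length as witness,
  whether or not \<open>N X n\<close> is infinite, so no case distinction is needed later.\<close>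

lemma less_N_iff: "x < N X n \<longleftrightarrow> (\<exists>k c. orthogonal_family X n k c \<and> x < enat k)"
  unfolding N_def less_SUP_iff by blast

theorem theorem4p3:
  fixes G :: "'a pair_pre_digraph" and H :: "'b pair_pre_digraph"
    and S :: "('a \<times> 'b) pair_pre_digraph" and m n :: nat
  assumes "pair_graph G" and "pair_graph H"
    and "m > 0" and "n > 0"
    and "pair_graph S" and "subgraph (with_proj S) (with_proj (or_product G H))"
  shows "N S (m * n) \<ge> min (N G m) (N H n)"
proof (rule ccontr)
  have fin: "finite (pverts G)" "finite (pverts H)"
    using assms(1,2)
    by (auto intro: pair_fin_digraph.pair_finite_verts simp: pair_graph_def pair_digraph_def)
  then have finp: "finite (pverts (or_product G H))"
    by (simp add: or_product_def)
  have sub: "pverts S \<subseteq> pverts (or_product G H)" "parcs S \<subseteq> parcs (or_product G H)"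
    using assms(6) by (auto simp: subgraph_def)
  assume "\<not> ?thesis"
  then have "N S (m * n) < N G m" "N S (m * n) < N H n"
    by (simp_all add: not_le)
  then obtain k c l d where
    c: "orthogonal_family G m k c" "N S (m * n) < enat k" and
    d: "orthogonal_family H n l d" "N S (m * n) < enat l"
    unfolding less_N_iff by blast
  \<comment> \<open>The two witnesses may differ in length; both are cut down to the shorter one,
    which is still longer than \<open>N S (m * n)\<close>.\<close>
  define r where "r = min k l"
  have "orthogonal_family G m r c" "orthogonal_family H n r d"
    using c(1) d(1) by (auto simp: r_def intro: orthogonal_family_le)
  then have "orthogonal_family S (m * n) r (\<lambda>i. product_coloring (c i) (d i))"
    by (intro orthogonal_family_mono[OF finp sub] orthogonal_family_or_product fin)
  moreover have "N S (m * n) < enat r"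
    using c(2) d(2) by (simp add: r_def min_def)
  \<comment> \<open>\<open>less_N_iff\<close> is applied with \<open>x\<close> equal to
    \<open>N S (m * n)\<close> itself, the family of length \<open>r\<close> on \<open>S\<close>
    being the witness.\<close>
  ultimately have "N S (m * n) < N S (m * n)"
    unfolding less_N_iff[of _ S] by blast
  then show False by simp
qed

end
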